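(* Let $K\ge1$. Suppose $S$ is a finite symmetric subset of a group containing the identity, and $|S^{2n}|\le K|S^n|$ for some integer $n\ge 2K^2$. Then $|S^{3n}|\le K^3(3^9K^{18})^{10\cdot5^{K^2}}|S^n|$, and $S^{2n}$ is a $K^9(3^9K^{18})^{30\cdot5^{K^2}}$-approximate group.
   Context: For a set $S$ and integer $m\ge1$, $S^m=\{s_1\cdots s_m: s_i\in S\}$. A set $S$ is symmetric if $S=S^{-1}$. For $L\ge1$, an $L$-approximate group is a symmetric subset $A$ of a group containing the identity such that $A^2$ is covered by at most $L$ left translates $xA$ of $A$. *)

theory Defs
  imports Complex_Main "HOL-Algebra.Coset"
begin

definition set_power :: "('a, 'b) monoid_scheme \<Rightarrow> 'a set \<Rightarrow> nat \<Rightarrow> 'a set" where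
  "set_power G S m =
     {foldr (\<lambda>x y. x \<otimes>\<^bsub>G\<^esub> y) xs \<one>\<^bsub>G\<^esub> | xs. length xs = m \<and> set xs \<subseteq> S}"

definition symmetric_subset :: "('a, 'b) monoid_scheme \<Rightarrow> 'a set \<Rightarrow> bool" where
  "symmetric_subset G S \<longleftrightarrow> S \<subseteq> carrier G \<and> S = set_inv\<^bsub>G\<^esub> S"

text \<open>The parameter \<open>L\<close> is real, as the bounds of interest are not integers; the covering
  set of translating elements may lie anywhere in the group, not necessarily in \<open>A\<close>.\<close>

definition approximate_group :: "('a, 'b) monoid_scheme \<Rightarrow> real \<Rightarrow> 'a set \<Rightarrow> bool" where
  "approximate_group G L A \<longleftrightarrow>
     1 \<le> L \<and> symmetric_subset G A \<and> \<one>\<^bsub>G\<^esub> \<in> A \<and>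
     (\<exists>X \<subseteq> carrier G. finite X \<and> real (card X) \<le> L \<and>
        set_power G A 2 \<subseteq> (\<Union>x\<in>X. x <#\<^bsub>G\<^esub> A))"

end

theory Submission
  imports Defs
begin

text \<open>Put \<open>A = S^n\<close> and let \<open>B\<close> be the symmetric set of all \<open>z\<close> with \<open>|A \<inter> zA| \<ge> |A| / (9K^3)\<close>.
  Counting representations gives \<open>|B^m| \<le> (9K^4)^m |A|\<close>, and since more than \<open>K^2 + 1\<close> nearly
  disjoint translates of \<open>A\<close> do not fit into \<open>A^2\<close>, at most \<open>K^2 + 1\<close> translates of \<open>B\<close> cover \<open>A\<close>.
  Replacing \<open>B^r\<close> by \<open>B^(5r)\<close> allows one of two close translates to be dropped, so after at
  most \<open>K^2\<close> such steps \<open>A\<close> is covered by translates of some \<open>H = B^q\<close> with \<open>q \<le> 5^(K^2)\<close> such that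
  no two of the centres differ by an element of \<open>H^4\<close>.

  The number of these translates met by \<open>S^i\<close> is at most \<open>K^2 + 1\<close>, so it stalls at some
  \<open>i \<le> K^2 \<le> n / 2\<close>, and the separation makes it stall for good. Hence \<open>A \<subseteq> W H^2\<close> for a small
  \<open>W \<subseteq> S^i\<close>, and \<open>S^(n-i) W \<subseteq> A \<subseteq> W H^2\<close> can be iterated to bound \<open>|S^(3n)|\<close> and \<open>|S^(5n)|\<close>. The
  bound on \<open>|S^(5n)|\<close> yields the covering of \<open>S^(4n)\<close> by Ruzsa's covering argument.\<close>

section \<open>Finite combinatorics: unions, chains and separated sets\<close>

text \<open>A Bonferroni-type bound. Inserting one more set loses at most \<open>card I * e\<close>
  to overlaps, while passing from \<open>card I ^ 2\<close> to \<open>(card I + 1) ^ 2\<close>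
  permits a loss of \<open>(2 * card I + 1) * e\<close>.\<close>

lemma card_UN_ge:
  fixes F :: "'i \<Rightarrow> 'b set"
  assumes "finite I" "\<And>i. i \<in> I \<Longrightarrow> finite (F i)" "\<And>i. i \<in> I \<Longrightarrow> card (F i) = a"
    and "\<And>i j. i \<in> I \<Longrightarrow> j \<in> I \<Longrightarrow> i \<noteq> j \<Longrightarrow> real (card (F i \<inter> F j)) \<le> e"
    and "0 \<le> e"
  shows "real (card I) * real a - real (card I) ^ 2 * e \<le> real (card (\<Union>i\<in>I. F i))"
  using assms
proof (induction I rule: finite_induct)
  case (insert x I)
  let ?U = "\<Union>i\<in>I. F i"
  have IH: "real (card I) * real a - real (card I) ^ 2 * e \<le> real (card ?U)"
    using insert.prems by (intro insert.IH) auto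
  have "F x \<inter> ?U = (\<Union>i\<in>I. F x \<inter> F i)" by blast
  then have "real (card (F x \<inter> ?U)) \<le> (\<Sum>i\<in>I. real (card (F x \<inter> F i)))"
    using card_UN_le[OF insert.hyps(1), of "\<lambda>i. F x \<inter> F i"]
    by (metis of_nat_le_iff of_nat_sum)
  also have "\<dots> \<le> (\<Sum>i\<in>I. e)"
    using insert.prems insert.hyps by (intro sum_mono) (metis insertCI)
  finally have "real (card (F x \<inter> ?U)) \<le> real (card I) * e" by simp
  moreover have "card (F x) + card ?U = card (F x \<union> ?U) + card (F x \<inter> ?U)"
    using insert.prems insert.hyps by (intro card_Un_Int) auto
  ultimately have "real a + real (card ?U) - real (card I) * e \<le> real (card (F x \<union> ?U))"
    using insert.prems(2)[of x] by simp
  with IH have "real a + (real (card I) * real a - real (card I) ^ 2 * e) - real (card I) * e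
      \<le> real (card (F x \<union> ?U))"
    by linarith
  moreover have "0 \<le> e + real (card I) * e" using insert.prems by simp
  moreover have "real (card (insert x I)) * real a - real (card (insert x I)) ^ 2 * e
      = real a + (real (card I) * real a - real (card I) ^ 2 * e) - real (card I) * e
        - (e + real (card I) * e)"
    using insert.hyps by (simp add: power2_eq_square algebra_simps)
  ultimately show ?case unfolding UN_insert by linarith
qed simp

text \<open>A strictly growing chain gains an element at each step. Because \<open>Y 0\<close> is
  nonempty, \<open>card (Y i)\<close> would exceed \<open>i\<close> throughout, which is why the
  stall occurs strictly before \<open>card X\<close>.\<close>

lemma chain_stabilises:
  fixes Y :: "nat \<Rightarrow> 'b set"
  assumes "finite X" "\<And>i. Y i \<subseteq> X" "\<And>i. Y i \<subseteq> Y (Suc i)" "Y 0 \<noteq> {}"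
  obtains i where "i < card X" "Y (Suc i) = Y i"
proof -
  have "\<exists>i<card X. Y (Suc i) = Y i"
  proof (rule ccontr)
    assume neg: "\<not> ?thesis"
    have fin: "finite (Y i)" for i using assms finite_subset by blast
    have "i < card (Y i)" if "i \<le> card X" for i
      using that
    proof (induction i)
      case 0
      then show ?case using assms(4) fin by (simp add: card_gt_0_iff)
    next
      case (Suc i)
      then have "Y (Suc i) \<noteq> Y i" using neg by auto
      then have "Y i \<subset> Y (Suc i)" using assms(3)[of i] by blast
      then have "card (Y i) < card (Y (Suc i))" using fin by (intro psubset_card_mono)
      then show ?case using Suc by simp
    qed
    from this[of "card X"] show False
      using card_mono[OF assms(1,2)] by (simp add: leD)
  qed
  then show thesis using that by blast
qed

text \<open>Greedy selection: an element is added exactly when nothing chosen so far is related to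
  it. It serves twice, with \<open>R\<close> meaning a popular quotient and with \<open>R\<close>
  meaning that two translates intersect.\<close>

lemma maximal_separated:
  assumes "finite C" "\<And>x. x \<in> C \<Longrightarrow> R x x" "\<And>x y. x \<in> C \<Longrightarrow> y \<in> C \<Longrightarrow> R x y \<Longrightarrow> R y x"
  obtains X where "X \<subseteq> C" "\<And>x y. x \<in> X \<Longrightarrow> y \<in> X \<Longrightarrow> x \<noteq> y \<Longrightarrow> \<not> R x y"
    "\<And>c. c \<in> C \<Longrightarrow> \<exists>x\<in>X. R x c"
proof -
  have "\<exists>X\<subseteq>C. (\<forall>x\<in>X. \<forall>y\<in>X. x \<noteq> y \<longrightarrow> \<not> R x y) \<and> (\<forall>c\<in>C. \<exists>x\<in>X. R x c)"
    using assms
  proof (induction C rule: finite_induct)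
    case (insert c C)
    then obtain X where X: "X \<subseteq> C" "\<forall>x\<in>X. \<forall>y\<in>X. x \<noteq> y \<longrightarrow> \<not> R x y" "\<forall>c\<in>C. \<exists>x\<in>X. R x c"
      by (metis insertCI)
    show ?case
    proof (cases "\<exists>x\<in>X. R x c")
      case True
      then show ?thesis using X by (intro exI[of _ X]) auto
    next
      case False
      then have "\<not> R c x" if "x \<in> X" for x
        using insert.prems(2)[of c x] X(1) that by blast
      then show ?thesis
        using X False insert.prems(1)[of c] by (intro exI[of _ "insert c X"]) auto
    qed
  qed simp
  then show thesis using that by metis
qed

section \<open>Product sets and powers of a set in a group\<close>

context group
begin

lemma set_power_0 [simp]: "set_power G S 0 = {\<one>}"
  by (simp add: set_power_def)

lemma set_power_Suc: "set_power G S (Suc m) = S <#> set_power G S m"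
proof
  show "set_power G S (Suc m) \<subseteq> S <#> set_power G S m"
    unfolding set_power_def set_mult_def by (fastforce simp: length_Suc_conv)
  show "S <#> set_power G S m \<subseteq> set_power G S (Suc m)"
  proof
    fix z assume "z \<in> S <#> set_power G S m"
    then obtain s xs where "s \<in> S" "length xs = m" "set xs \<subseteq> S" "z = s \<otimes> foldr (\<otimes>) xs \<one>"
      unfolding set_power_def set_mult_def by auto
    then have "z = foldr (\<otimes>) (s # xs) \<one> \<and> length (s # xs) = Suc m \<and> set (s # xs) \<subseteq> S" by auto
    then show "z \<in> set_power G S (Suc m)"
      unfolding set_power_def by blast
  qed
qed

lemma set_multI: "a \<in> X \<Longrightarrow> b \<in> Y \<Longrightarrow> a \<otimes> b \<in> X <#> Y"
  unfolding set_mult_def by blast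

lemma set_multE:
  assumes "z \<in> X <#> Y"
  obtains a b where "a \<in> X" "b \<in> Y" "z = a \<otimes> b"
  using assms unfolding set_mult_def by blast

lemma set_mult_eq_image: "X <#> Y = (\<lambda>(a, b). a \<otimes> b) ` (X \<times> Y)"
  unfolding set_mult_def by auto

lemma finite_set_mult: "finite X \<Longrightarrow> finite Y \<Longrightarrow> finite (X <#> Y)"
  by (simp add: set_mult_eq_image)

lemma card_set_mult_le:
  assumes "finite X" "finite Y" shows "card (X <#> Y) \<le> card X * card Y"
  using card_image_le[of "X \<times> Y" "\<lambda>(a, b). a \<otimes> b"] assms
  by (simp add: set_mult_eq_image card_cartesian_product)

lemma set_power_closed: "S \<subseteq> carrier G \<Longrightarrow> set_power G S m \<subseteq> carrier G"
  by (induction m) (auto simp: set_power_Suc set_mult_closed)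

lemma finite_set_power: "finite S \<Longrightarrow> finite (set_power G S m)"
  by (induction m) (auto simp: set_power_Suc finite_set_mult)

lemma one_set_mult: "X \<subseteq> carrier G \<Longrightarrow> {\<one>} <#> X = X"
  unfolding set_mult_def by force

lemma set_mult_one: "X \<subseteq> carrier G \<Longrightarrow> X <#> {\<one>} = X"
  unfolding set_mult_def by force

lemma set_power_add:
  assumes "S \<subseteq> carrier G"
  shows "set_power G S (k + m) = set_power G S k <#> set_power G S m"
proof (induction k)
  case 0
  then show ?case using set_power_closed[OF assms] by (simp add: one_set_mult)
next
  case (Suc k)
  then show ?case
    using set_power_closed[OF assms] assms by (simp add: set_power_Suc set_mult_assoc)
qed

lemma set_power_add_memI:
  assumes "S \<subseteq> carrier G" "x \<in> set_power G S k" "y \<in> set_power G S m"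
  shows "x \<otimes> y \<in> set_power G S (k + m)"
  using assms by (simp add: set_power_add set_multI)

lemma set_power_1: "S \<subseteq> carrier G \<Longrightarrow> set_power G S (Suc 0) = S"
  by (simp add: set_power_Suc set_mult_one)

lemma set_power_2: "S \<subseteq> carrier G \<Longrightarrow> set_power G S 2 = S <#> S"
  by (simp add: numeral_2_eq_2 set_power_Suc set_mult_one)

lemma one_in_set_power: "\<one> \<in> S \<Longrightarrow> \<one> \<in> set_power G S m"
  by (induction m) (use set_multI[of \<one> S \<one>] in \<open>auto simp: set_power_Suc\<close>)

lemma set_power_mono:
  assumes "S \<subseteq> carrier G" "\<one> \<in> S" "k \<le> m"
  shows "set_power G S k \<subseteq> set_power G S m"
proof
  fix x assume x: "x \<in> set_power G S k"
  have "x \<otimes> \<one> \<in> set_power G S (k + (m - k))"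
    using assms x by (intro set_power_add_memI one_in_set_power)
  then show "x \<in> set_power G S m"
    using assms x set_power_closed[OF assms(1)] by (auto simp: subset_iff)
qed

lemma symmetric_subset_iff:
  "symmetric_subset G S \<longleftrightarrow> S \<subseteq> carrier G \<and> (\<forall>x\<in>S. inv x \<in> S)"
proof -
  have "S = set_inv S" if "S \<subseteq> carrier G" "\<forall>x\<in>S. inv x \<in> S"
  proof -
    have "x = inv (inv x)" if "x \<in> S" for x
      using that \<open>S \<subseteq> carrier G\<close> by auto
    then show ?thesis using that unfolding SET_INV_def by blast
  qed
  then show ?thesis
    unfolding symmetric_subset_def SET_INV_def by blast
qed

lemma symmetric_subset_set_power:
  assumes "symmetric_subset G S"
  shows "symmetric_subset G (set_power G S m)"
proof -
  have S: "S \<subseteq> carrier G" and inv_S: "\<And>x. x \<in> S \<Longrightarrow> inv x \<in> S"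
    using assms by (auto simp: symmetric_subset_iff)
  have "\<forall>x\<in>set_power G S m. inv x \<in> set_power G S m"
  proof (induction m)
    case (Suc m)
    show ?case
    proof
      fix x assume "x \<in> set_power G S (Suc m)"
      then obtain s y where sy: "s \<in> S" "y \<in> set_power G S m" "x = s \<otimes> y"
        unfolding set_power_Suc by (rule set_multE)
      have "inv y \<otimes> inv s \<in> set_power G S (m + Suc 0)"
        using S sy Suc inv_S by (intro set_power_add_memI) (auto simp: set_power_1)
      moreover have "inv x = inv y \<otimes> inv s"
        using sy S set_power_closed[OF S] by (auto intro!: inv_mult_group)
      ultimately show "inv x \<in> set_power G S (Suc m)" by simp
    qed
  qed simp
  then show ?thesis
    using set_power_closed[OF S] by (simp add: symmetric_subset_iff)
qed

section \<open>Popular quotients and the growth of their powers\<close>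

text \<open>This is the symmetry set of \<open>A\<close> at level \<open>d\<close>: for
  \<open>A\<close> inside the group, the cardinality on the right is that of the intersection of
  \<open>A\<close> with \<open>zA\<close>, and also the number of ways to write \<open>z\<close> as
  \<open>a \<otimes> inv b\<close> with \<open>a\<close> and \<open>b\<close> in
  \<open>A\<close>.\<close>

definition popular :: "'a set \<Rightarrow> real \<Rightarrow> 'a set" where
  "popular A d = {z \<in> carrier G. d * real (card A) \<le> real (card {b \<in> A. z \<otimes> b \<in> A})}"

lemma popular_closed: "popular A d \<subseteq> carrier G"
  by (auto simp: popular_def)

lemma one_in_popular: "A \<subseteq> carrier G \<Longrightarrow> d \<le> 1 \<Longrightarrow> \<one> \<in> popular A d"
proof -
  assume "A \<subseteq> carrier G" "d \<le> 1"
  then have "{b \<in> A. \<one> \<otimes> b \<in> A} = A" by auto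
  then show ?thesis
    using mult_right_mono[OF \<open>d \<le> 1\<close>, of "real (card A)"] by (simp add: popular_def)
qed

text \<open>Left multiplication by \<open>z\<close> injects the elements counted for
  \<open>z\<close> into those counted for \<open>inv z\<close>.\<close>

lemma inv_in_popular:
  assumes "A \<subseteq> carrier G" "finite A" "z \<in> popular A d"
  shows "inv z \<in> popular A d"
proof -
  have z: "z \<in> carrier G" using assms popular_closed by blast
  have "card {b \<in> A. z \<otimes> b \<in> A} \<le> card {b \<in> A. inv z \<otimes> b \<in> A}"
  proof (rule card_inj_on_le)
    show "inj_on (\<lambda>b. z \<otimes> b) {b \<in> A. z \<otimes> b \<in> A}"
      using z assms(1) by (intro inj_onI) (auto simp: subset_iff)
    show "(\<lambda>b. z \<otimes> b) ` {b \<in> A. z \<otimes> b \<in> A} \<subseteq> {b \<in> A. inv z \<otimes> b \<in> A}"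
      using z assms(1) by (auto simp: inv_solve_left' m_assoc[symmetric] subset_iff)
  qed (use assms in auto)
  then show ?thesis using assms(3) z by (simp add: popular_def)
qed

lemma symmetric_popular:
  "A \<subseteq> carrier G \<Longrightarrow> finite A \<Longrightarrow> symmetric_subset G (popular A d)"
  by (simp add: symmetric_subset_iff popular_closed inv_in_popular)

lemma finite_popular:
  assumes "A \<subseteq> carrier G" "finite A" "A \<noteq> {}" "0 < d"
  shows "finite (popular A d)"
proof (rule finite_subset)
  show "popular A d \<subseteq> (\<lambda>(a, b). a \<otimes> inv b) ` (A \<times> A)"
  proof
    fix z assume z: "z \<in> popular A d"
    have "0 < d * real (card A)" using assms by (simp add: card_gt_0_iff)
    then have "card {b \<in> A. z \<otimes> b \<in> A} \<noteq> 0"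
      using z by (auto simp: popular_def)
    then obtain b where b: "b \<in> A" "z \<otimes> b \<in> A"
      by (metis (no_types, lifting) card.empty empty_Collect_eq)
    moreover have "z = (z \<otimes> b) \<otimes> inv b"
      using b z assms(1) popular_closed by (metis inv_solve_right m_closed subsetD)
    ultimately show "z \<in> (\<lambda>(a, b). a \<otimes> inv b) ` (A \<times> A)" by force
  qed
qed (use assms in auto)

text \<open>The number of \<open>(a, c\<^sub>1, \<dots>, c\<^sub>m) \<in> A \<times> D\<^sup>m\<close> with \<open>a c\<^sub>1 \<cdots> c\<^sub>m = y\<close>.\<close>

primrec rep_count :: "'a set \<Rightarrow> 'a set \<Rightarrow> nat \<Rightarrow> 'a \<Rightarrow> real" where
  "rep_count A D 0 y = (if y \<in> A then 1 else 0)"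
| "rep_count A D (Suc m) y = (\<Sum>c\<in>D. rep_count A D m (y \<otimes> inv c))"

lemma rep_count_nonneg: "0 \<le> rep_count A D m y"
  by (induction m arbitrary: y) (auto intro: sum_nonneg)

text \<open>Each tuple has only one product, so summing over distinct \<open>y\<close> counts no
  tuple twice; the right side is the number of all tuples.\<close>

lemma sum_rep_count_le:
  assumes "finite A" "finite D" "D \<subseteq> carrier G" "finite Y" "Y \<subseteq> carrier G"
  shows "(\<Sum>y\<in>Y. rep_count A D m y) \<le> real (card A) * real (card D) ^ m"
  using assms(4,5)
proof (induction m arbitrary: Y)
  case 0
  have "(\<Sum>y\<in>Y. rep_count A D 0 y) = real (card (Y \<inter> A))"
    using 0 by (simp add: sum.If_cases)
  also have "\<dots> \<le> real (card A)"
    using assms by (simp add: card_mono)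
  finally show ?case by simp
next
  case (Suc m)
  have "(\<Sum>y\<in>Y. rep_count A D (Suc m) y) = (\<Sum>c\<in>D. \<Sum>y\<in>Y. rep_count A D m (y \<otimes> inv c))"
    by simp (rule sum.swap)
  also have "\<dots> \<le> (\<Sum>c\<in>D. real (card A) * real (card D) ^ m)"
  proof (rule sum_mono)
    fix c assume c: "c \<in> D"
    have "inj_on (\<lambda>y. y \<otimes> inv c) Y"
      using c assms(3) Suc.prems by (intro inj_onI) (auto simp: subset_iff)
    then have "(\<Sum>y\<in>Y. rep_count A D m (y \<otimes> inv c))
        = (\<Sum>y\<in>(\<lambda>y. y \<otimes> inv c) ` Y. rep_count A D m y)"
      by (simp add: sum.reindex)
    also have "\<dots> \<le> real (card A) * real (card D) ^ m"
      using c assms(3) Suc.prems by (intro Suc.IH) auto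
    finally show "(\<Sum>y\<in>Y. rep_count A D m (y \<otimes> inv c)) \<le> real (card A) * real (card D) ^ m" .
  qed
  finally show ?case by (simp add: algebra_simps)
qed

text \<open>If \<open>z b = a\<close> with \<open>a, b \<in> A\<close>, then \<open>x z b = (x b') (b'\<^sup>-\<^sup>1 a)\<close> for every \<open>b' \<in> A\<close>, so each of the many
  such \<open>b\<close> for a popular \<open>z\<close> turns representations of all the \<open>x b'\<close> into one of \<open>x z b\<close>.\<close>

lemma sum_rep_count_popular_ge:
  assumes "A \<subseteq> carrier G" "finite A" "finite D" "0 \<le> d"
    and D: "\<And>a b. a \<in> A \<Longrightarrow> b \<in> A \<Longrightarrow> inv b \<otimes> a \<in> D"
    and "x \<in> set_power G (popular A d) m"
  shows "real (card A) * (d * real (card A)) ^ m \<le> (\<Sum>b\<in>A. rep_count A D m (x \<otimes> b))"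
  using assms(6)
proof (induction m arbitrary: x)
  case 0
  then have "(\<Sum>b\<in>A. rep_count A D 0 (x \<otimes> b)) = (\<Sum>b\<in>A. 1)"
    using assms(1) by (intro sum.cong) auto
  then show ?case by simp
next
  case (Suc m)
  let ?R = "real (card A) * (d * real (card A)) ^ m"
  \<comment> \<open>\<open>set_power_Suc\<close> would split off the first factor; here the last
    factor is wanted, since it is the one that meets \<open>b\<close>.\<close>
  have "x \<in> set_power G (popular A d) (m + Suc 0)" using Suc.prems by simp
  then obtain w z where wz: "w \<in> set_power G (popular A d) m" "z \<in> popular A d" "x = w \<otimes> z"
    by (subst (asm) set_power_add[OF popular_closed])
       (auto simp: set_power_1 popular_closed elim: set_multE)
  have car: "w \<in> carrier G" "z \<in> carrier G"
    using wz popular_closed set_power_closed[OF popular_closed] by blast+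
  have R: "?R \<le> rep_count A D (Suc m) (x \<otimes> b)" if b: "b \<in> A" "z \<otimes> b \<in> A" for b
  proof -
    \<comment> \<open>The value at \<open>b'\<close> is the last factor in the new representation of
      \<open>x \<otimes> b\<close>. It determines \<open>b'\<close> and lies in \<open>D\<close>, so
      the sum over \<open>b'\<close> is part of the sum defining \<open>rep_count\<close>.\<close>
    let ?g = "\<lambda>b'. inv b' \<otimes> (z \<otimes> b)"
    have inj: "inj_on ?g A"
      using b assms(1) car by (intro inj_onI) (metis inv_closed inv_inv right_cancel subsetD)
    have "?R \<le> (\<Sum>b'\<in>A. rep_count A D m (w \<otimes> b'))" using Suc.IH wz by simp
    also have "\<dots> = (\<Sum>b'\<in>A. rep_count A D m (x \<otimes> b \<otimes> inv (?g b')))"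
    proof (rule sum.cong)
      fix b' assume b': "b' \<in> A"
      have c: "b \<in> carrier G" "b' \<in> carrier G" using b b' assms(1) by auto
      have "x \<otimes> b \<otimes> inv (?g b') = w \<otimes> (z \<otimes> b) \<otimes> (inv (z \<otimes> b) \<otimes> b')"
        using c car wz by (simp add: inv_mult_group m_assoc)
      also have "\<dots> = w \<otimes> b'"
        using c car by (metis inv_closed inv_solve_left m_assoc m_closed r_inv l_one)
      finally show "rep_count A D m (w \<otimes> b') = rep_count A D m (x \<otimes> b \<otimes> inv (?g b'))" by simp
    qed simp
    also have "\<dots> = (\<Sum>c\<in>?g ` A. rep_count A D m (x \<otimes> b \<otimes> inv c))"
      using inj by (simp add: sum.reindex)
    also have "\<dots> \<le> (\<Sum>c\<in>D. rep_count A D m (x \<otimes> b \<otimes> inv c))"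
      using assms(3) D b by (intro sum_mono2) (auto simp: rep_count_nonneg)
    finally show ?thesis by simp
  qed
  have "?R * (d * real (card A)) \<le> ?R * real (card {b \<in> A. z \<otimes> b \<in> A})"
    using wz assms(4) by (intro mult_left_mono) (auto simp: popular_def)
  also have "\<dots> = (\<Sum>b\<in>{b \<in> A. z \<otimes> b \<in> A}. ?R)" by simp
  also have "\<dots> \<le> (\<Sum>b\<in>{b \<in> A. z \<otimes> b \<in> A}. rep_count A D (Suc m) (x \<otimes> b))"
    using R by (intro sum_mono) blast
  also have "\<dots> \<le> (\<Sum>b\<in>A. rep_count A D (Suc m) (x \<otimes> b))"
    using assms(2) by (intro sum_mono2) (auto simp del: rep_count.simps simp: rep_count_nonneg)
  finally show ?case by (simp add: algebra_simps)
qed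

text \<open>Double counting over pairs \<open>(x, b)\<close> with \<open>x\<close> in the power and
  \<open>b\<close> in \<open>A\<close>: each \<open>x\<close> contributes many representations of
  the products \<open>x \<otimes> b\<close>, while for fixed \<open>b\<close> these products are
  distinct and share at most \<open>card A * card D ^ m\<close> representations.\<close>

lemma card_set_power_popular_le:
  assumes "A \<subseteq> carrier G" "finite A" "A \<noteq> {}" "finite D" "D \<subseteq> carrier G" "0 < d"
    and D: "\<And>a b. a \<in> A \<Longrightarrow> b \<in> A \<Longrightarrow> inv b \<otimes> a \<in> D"
    and K: "real (card D) \<le> K * real (card A)"
  shows "real (card (set_power G (popular A d) m)) \<le> (K / d) ^ m * real (card A)"
proof -
  let ?P = "set_power G (popular A d) m" and ?a = "real (card A)"
  have a: "0 < ?a" using assms by (simp add: card_gt_0_iff)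
  have P: "finite ?P" "?P \<subseteq> carrier G"
    using assms by (auto intro: finite_set_power finite_popular set_power_closed[OF popular_closed, THEN subsetD])
  have "real (card ?P) * (?a * (d * ?a) ^ m) = (\<Sum>x\<in>?P. ?a * (d * ?a) ^ m)" by simp
  also have "\<dots> \<le> (\<Sum>x\<in>?P. \<Sum>b\<in>A. rep_count A D m (x \<otimes> b))"
    using assms by (intro sum_mono sum_rep_count_popular_ge) auto
  also have "\<dots> = (\<Sum>b\<in>A. \<Sum>x\<in>?P. rep_count A D m (x \<otimes> b))" by (rule sum.swap)
  also have "\<dots> \<le> (\<Sum>b\<in>A. ?a * real (card D) ^ m)"
  proof (rule sum_mono)
    fix b assume b: "b \<in> A"
    have "inj_on (\<lambda>x. x \<otimes> b) ?P"
      using b assms(1) P by (intro inj_onI) (auto simp: subset_iff)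
    then have "(\<Sum>x\<in>?P. rep_count A D m (x \<otimes> b)) = (\<Sum>y\<in>(\<lambda>x. x \<otimes> b) ` ?P. rep_count A D m y)"
      by (simp add: sum.reindex)
    also have "\<dots> \<le> ?a * real (card D) ^ m"
      using b assms P by (intro sum_rep_count_le) auto
    finally show "(\<Sum>x\<in>?P. rep_count A D m (x \<otimes> b)) \<le> ?a * real (card D) ^ m" .
  qed
  also have "\<dots> \<le> ?a * (?a * (K * ?a) ^ m)"
    using K by (simp add: mult_left_mono power_mono)
  finally have "?a * (real (card ?P) * (d * ?a) ^ m) \<le> ?a * (?a * (K * ?a) ^ m)"
    by (simp add: algebra_simps)
  then have "real (card ?P) * (d * ?a) ^ m \<le> ?a * (K * ?a) ^ m"
    using a by (simp add: mult_le_cancel_left_pos)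
  then have "real (card ?P) \<le> ?a * (K * ?a) ^ m / (d * ?a) ^ m"
    using a assms(6) by (simp add: pos_le_divide_eq)
  also have "\<dots> = (K / d) ^ m * ?a"
    using a by (simp add: power_mult_distrib power_divide)
  finally show ?thesis .
qed

section \<open>Covering by translates of popular sets\<close>

lemma card_l_coset: "A \<subseteq> carrier G \<Longrightarrow> x \<in> carrier G \<Longrightarrow> card ((\<otimes>) x ` A) = card A"
  by (intro card_image inj_onI) (auto simp: subset_iff)

text \<open>An unpopular quotient \<open>inv x \<otimes> y\<close> means that \<open>xA\<close> and
  \<open>yA\<close> overlap in fewer than \<open>card A / (9 * K ^ 3)\<close> points. Too many such
  translates would have a union larger than \<open>A <#> A\<close>, which contains them.\<close>

lemma card_popular_separated_le:
  assumes "A \<subseteq> carrier G" "finite A" "A \<noteq> {}" "1 \<le> K"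
    and "real (card (A <#> A)) \<le> K * real (card A)"
    and "X \<subseteq> A"
    and sep: "\<And>x y. x \<in> X \<Longrightarrow> y \<in> X \<Longrightarrow> x \<noteq> y \<Longrightarrow> inv x \<otimes> y \<notin> popular A (1 / (9 * K ^ 3))"
  shows "real (card X) \<le> K ^ 2 + 1"
proof (rule ccontr)
  assume big: "\<not> ?thesis"
  define a where "a = real (card A)"
  \<comment> \<open>The least integer above \<open>K ^ 2 + 1\<close>. Working with exactly
    \<open>k\<close> translates keeps \<open>k\<close> at most \<open>3 * K ^ 2\<close>, so the
    overlap term \<open>k ^ 2 / (9 * K ^ 3)\<close> is at most \<open>K\<close>.\<close>
  define k where "k = nat \<lfloor>K ^ 2\<rfloor> + 2"
  have a: "0 < a" using assms by (simp add: a_def card_gt_0_iff)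
  have k: "K ^ 2 + 1 < real k" "real k \<le> K ^ 2 + 2"
    unfolding k_def using floor_correct[of "K ^ 2"] by (auto simp: add.commute)
  have "real k < real (card X) + 1" using k big by linarith
  then have "k \<le> card X" by linarith
  then obtain Y where Y: "Y \<subseteq> X" "card Y = k" "finite Y"
    using obtain_subset_with_card_n by metis
  have car: "x \<in> carrier G" if "x \<in> Y" for x using that Y assms by blast
  let ?e = "a / (9 * K ^ 3)"
  have "real (card Y) * real (card A) - real (card Y) ^ 2 * ?e \<le> real (card (\<Union>x\<in>Y. (\<otimes>) x ` A))"
  proof (rule card_UN_ge)
    fix x y assume xy: "x \<in> Y" "y \<in> Y" "x \<noteq> y"
    let ?P = "{b \<in> A. inv x \<otimes> y \<otimes> b \<in> A}"
    have "(\<otimes>) x ` A \<inter> (\<otimes>) y ` A \<subseteq> (\<otimes>) y ` ?P"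
    proof
      fix u assume "u \<in> (\<otimes>) x ` A \<inter> (\<otimes>) y ` A"
      then obtain c b where cb: "c \<in> A" "b \<in> A" "u = x \<otimes> c" "u = y \<otimes> b" by auto
      then have c: "c \<in> carrier G" "b \<in> carrier G" using assms by auto
      have "inv x \<otimes> y \<otimes> b = inv x \<otimes> (x \<otimes> c)"
        using cb c car xy by (simp add: m_assoc)
      then have "inv x \<otimes> y \<otimes> b = c"
        using c car xy by (simp add: m_assoc[symmetric])
      then show "u \<in> (\<otimes>) y ` ?P" using cb(1,2,4) by blast
    qed
    then have "card ((\<otimes>) x ` A \<inter> (\<otimes>) y ` A) \<le> card ((\<otimes>) y ` ?P)"
      using assms(2) by (intro card_mono) auto
    also have "\<dots> \<le> card ?P" using assms(2) by (intro card_image_le) auto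
    finally have "card ((\<otimes>) x ` A \<inter> (\<otimes>) y ` A) \<le> card ?P" .
    moreover have "real (card ?P) < ?e"
      using sep[of x y] xy Y car by (auto simp: popular_def a_def not_le)
    ultimately show "real (card ((\<otimes>) x ` A \<inter> (\<otimes>) y ` A)) \<le> ?e" by linarith
  qed (use Y car assms a in \<open>auto simp: card_l_coset\<close>)
  also have "\<dots> \<le> real (card (A <#> A))"
  proof -
    have "(\<Union>x\<in>Y. (\<otimes>) x ` A) \<subseteq> A <#> A"
      using Y assms(6) unfolding set_mult_def by blast
    then show ?thesis using assms(2) by (simp add: card_mono finite_set_mult)
  qed
  also have "\<dots> \<le> K * a" using assms(5) by (simp add: a_def)
  finally have "a * (real k - real k ^ 2 / (9 * K ^ 3)) \<le> a * K"
    using Y by (simp add: a_def algebra_simps)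
  then have 1: "real k - real k ^ 2 / (9 * K ^ 3) \<le> K"
    using a by (simp only: mult_le_cancel_left_pos)
  have "1 \<le> K ^ 2" using assms(4) by simp
  then have "real k \<le> 3 * K ^ 2" using k by linarith
  then have "real k ^ 2 \<le> (3 * K ^ 2) ^ 2" by (intro power_mono) auto
  also have "\<dots> = K * (9 * K ^ 3)" by (simp add: power2_eq_square power3_eq_cube)
  finally have "real k ^ 2 / (9 * K ^ 3) \<le> K"
    using assms(4) by (simp add: pos_divide_le_eq)
  \<comment> \<open>The two bounds give \<open>k \<le> 2 * K\<close>, against
    \<open>k > K ^ 2 + 1\<close>.\<close>
  with 1 k have "K ^ 2 + 1 < 2 * K" by linarith
  moreover have "0 \<le> (K - 1) ^ 2" by simp
  ultimately show False by (simp add: power2_eq_square algebra_simps)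
qed

text \<open>A maximal subset of \<open>A\<close> without popular quotients is small by the preceding
  bound, and maximality makes it a set of centres for a cover.\<close>

lemma popular_cover:
  assumes "A \<subseteq> carrier G" "finite A" "\<one> \<in> A" "1 \<le> K"
    and "real (card (A <#> A)) \<le> K * real (card A)"
  obtains X where "X \<subseteq> A" "real (card X) \<le> K ^ 2 + 1" "A \<subseteq> X <#> popular A (1 / (9 * K ^ 3))"
proof -
  let ?B = "popular A (1 / (9 * K ^ 3))"
  have "1 \<le> K ^ 3" using assms(4) by simp
  then have "1 / (9 * K ^ 3) \<le> 1"
    by (subst pos_divide_le_eq; linarith)
  then have one: "\<one> \<in> ?B"
    using assms(1) by (intro one_in_popular)
  obtain X where X: "X \<subseteq> A" "\<And>x y. x \<in> X \<Longrightarrow> y \<in> X \<Longrightarrow> x \<noteq> y \<Longrightarrow> inv x \<otimes> y \<notin> ?B"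
    "\<And>c. c \<in> A \<Longrightarrow> \<exists>x\<in>X. inv x \<otimes> c \<in> ?B"
  proof (rule maximal_separated[of A "\<lambda>x y. inv x \<otimes> y \<in> ?B"])
    fix x y assume xy: "x \<in> A" "y \<in> A" "inv x \<otimes> y \<in> ?B"
    then have "x \<in> carrier G" "y \<in> carrier G" using assms by auto
    moreover have "inv (inv x \<otimes> y) \<in> ?B" using inv_in_popular assms xy by blast
    ultimately show "inv y \<otimes> x \<in> ?B" by (simp add: inv_mult_group)
  qed (use assms one in \<open>auto simp: subset_iff\<close>)
  show thesis
  proof
    show "A \<subseteq> X <#> ?B"
    proof
      fix c assume c: "c \<in> A"
      then obtain x where x: "x \<in> X" "inv x \<otimes> c \<in> ?B" using X by blast
      have "x \<otimes> (inv x \<otimes> c) = c"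
        using c x X assms by (metis inv_solve_left m_closed inv_closed subsetD)
      then show "c \<in> X <#> ?B" using set_multI[OF x] by simp
    qed
    show "real (card X) \<le> K ^ 2 + 1"
      using X assms by (intro card_popular_separated_le[of A]) auto
  qed (rule X)
qed

lemma merge_cover:
  assumes "B \<subseteq> carrier G" "\<one> \<in> B" "finite X" "X \<subseteq> carrier G" "A \<subseteq> X <#> set_power G B r"
  obtains Y q where "Y \<subseteq> X" "q \<le> r * 5 ^ (card X - 1)" "A \<subseteq> Y <#> set_power G B q"
    "\<And>x y. x \<in> Y \<Longrightarrow> y \<in> Y \<Longrightarrow> x \<noteq> y \<Longrightarrow> inv x \<otimes> y \<notin> set_power G B (4 * q)"
proof -
  have "\<exists>Y q. Y \<subseteq> X \<and> q \<le> r * 5 ^ (card X - 1) \<and> A \<subseteq> Y <#> set_power G B q \<and>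
    (\<forall>x\<in>Y. \<forall>y\<in>Y. x \<noteq> y \<longrightarrow> inv x \<otimes> y \<notin> set_power G B (4 * q))"
    using assms(3-5)
  proof (induction "card X" arbitrary: X r rule: less_induct)
    case less
    show ?case
    proof (cases "\<forall>x\<in>X. \<forall>y\<in>X. x \<noteq> y \<longrightarrow> inv x \<otimes> y \<notin> set_power G B (4 * r)")
      case True
      then show ?thesis using less.prems by (intro exI[of _ X] exI[of _ r]) auto
    next
      case False
      then obtain x y where xy: "x \<in> X" "y \<in> X" "x \<noteq> y" "inv x \<otimes> y \<in> set_power G B (4 * r)"
        by blast
      have car: "x \<in> carrier G" "y \<in> carrier G" using xy less.prems by auto
      have "A \<subseteq> (X - {y}) <#> set_power G B (5 * r)"
      proof
        fix u assume "u \<in> A"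
        then obtain z b where zb: "z \<in> X" "b \<in> set_power G B r" "u = z \<otimes> b"
          using less.prems by (blast elim: set_multE)
        show "u \<in> (X - {y}) <#> set_power G B (5 * r)"
        proof (cases "z = y")
          case True
          have b: "b \<in> carrier G" using zb set_power_closed[OF assms(1)] by blast
          have "inv x \<otimes> y \<otimes> b \<in> set_power G B (4 * r + r)"
            using set_power_add_memI assms(1) xy zb by blast
          then have "x \<otimes> (inv x \<otimes> y \<otimes> b) \<in> (X - {y}) <#> set_power G B (5 * r)"
            using xy by (intro set_multI) auto
          moreover have "x \<otimes> (inv x \<otimes> y \<otimes> b) = u"
            using zb True b car by (simp add: m_assoc[symmetric])
          ultimately show ?thesis by simp
        next
          case False
          have "b \<in> set_power G B (5 * r)"
            using set_power_mono[OF assms(1,2), of r "5 * r"] zb by auto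
          then show ?thesis using zb False by (auto intro: set_multI)
        qed
      qed
      moreover have "card (X - {y}) < card X" "finite (X - {y})" "X - {y} \<subseteq> carrier G"
        using xy less.prems by (auto simp del: card_Diff_insert intro!: card_Diff1_less)
      ultimately obtain Y q where Y: "Y \<subseteq> X - {y}" "q \<le> 5 * r * 5 ^ (card (X - {y}) - 1)"
        "A \<subseteq> Y <#> set_power G B q"
        "\<forall>x\<in>Y. \<forall>y\<in>Y. x \<noteq> y \<longrightarrow> inv x \<otimes> y \<notin> set_power G B (4 * q)"
        using less.hyps by meson
      \<comment> \<open>Two distinct centres make \<open>card X\<close> at least 2, so neither
        subtraction of 1 truncates at zero.\<close>
      have "card {x, y} \<le> card X" using xy less.prems by (intro card_mono) auto
      then have "card X - 1 = Suc (card (X - {y}) - 1)"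
        using xy less.prems by simp
      then have "q \<le> r * 5 ^ (card X - 1)" using Y(2) by simp
      then show ?thesis using Y by blast
    qed
  qed
  then show thesis using that by metis
qed

section \<open>Stabilisation of the cells met by the powers of \<open>S\<close>\<close>

text \<open>The sets \<open>Y i\<close> of cells \<open>x H\<close> met by \<open>S\<^sup>i\<close> grow with \<open>i\<close>. Once \<open>Y (i + 1) = Y i\<close>, multiplying by
  a further element of \<open>S\<close> moves a point of a cell of \<open>Y i\<close> within distance \<open>H\<^sup>4\<close> of another cell
  of \<open>Y i\<close>, so by separation no new cell is ever met.\<close>

lemma stable_cover:
  assumes S: "S \<subseteq> carrier G" "\<one> \<in> S" and B: "symmetric_subset G B" "\<one> \<in> B"
    and X: "finite X" "X \<subseteq> carrier G" "card X \<le> n"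
    and cov: "set_power G S n \<subseteq> X <#> set_power G B q"
    and sep: "\<And>x y. x \<in> X \<Longrightarrow> y \<in> X \<Longrightarrow> x \<noteq> y \<Longrightarrow> inv x \<otimes> y \<notin> set_power G B (4 * q)"
  obtains i W where "i < card X" "finite W" "W \<subseteq> carrier G" "card W \<le> card X"
    "\<And>j. set_power G S (n + j * (n - i)) \<subseteq> W <#> set_power G B ((2 * j + 2) * q)"
proof -
  let ?H = "set_power G B q"
  have Bc: "B \<subseteq> carrier G" using B by (simp add: symmetric_subset_iff)
  have Hc: "h \<in> carrier G" if "h \<in> ?H" for h using that set_power_closed[OF Bc] by blast
  have Hinv: "inv h \<in> ?H" if "h \<in> ?H" for h
    using that symmetric_subset_set_power[OF B(1), of q] by (simp add: symmetric_subset_iff)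
  have Sc: "u \<in> carrier G" if "u \<in> set_power G S m" for u m
    using that set_power_closed[OF S(1)] by blast
  have Xc: "x \<in> carrier G" if "x \<in> X" for x using that X by blast
  define Y where "Y i = {x \<in> X. \<exists>h\<in>?H. x \<otimes> h \<in> set_power G S i}" for i
  have cell: "\<exists>x\<in>Y j. \<exists>h\<in>?H. u = x \<otimes> h" if "u \<in> set_power G S j" "j \<le> n" for u j
  proof -
    have "u \<in> X <#> ?H" using that set_power_mono[OF S, of j n] cov by blast
    then obtain x h where "x \<in> X" "h \<in> ?H" "u = x \<otimes> h" by (rule set_multE)
    then show ?thesis using that unfolding Y_def by blast
  qed
  have YX: "Y i \<subseteq> X" for i by (auto simp: Y_def)
  have Ymono: "Y i \<subseteq> Y (Suc i)" for i
    using set_power_mono[OF S, of i "Suc i"] by (auto simp: Y_def)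
  have "Y 0 \<noteq> {}" using cell[of \<one> 0] by auto
  then obtain i where i: "i < card X" "Y (Suc i) = Y i"
    using chain_stabilises[of X Y] X(1) YX Ymono by blast
  have stable: "Y j \<subseteq> Y i" if "i \<le> j" "j \<le> n" for j
    using that
  proof (induction j rule: dec_induct)
    case (step j)
    show ?case
    proof
      fix x assume "x \<in> Y (Suc j)"
      then obtain h3 where x: "x \<in> X" "h3 \<in> ?H" "x \<otimes> h3 \<in> set_power G S (Suc j)"
        by (auto simp: Y_def)
      from x(3) obtain s v where sv: "s \<in> S" "v \<in> set_power G S j" "x \<otimes> h3 = s \<otimes> v"
        unfolding set_power_Suc by (rule set_multE)
      obtain y h2 where y: "y \<in> Y j" "h2 \<in> ?H" "v = y \<otimes> h2"
        using cell sv step by (meson Suc_leD)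
      then have "y \<in> Y i" using step by auto
      then obtain h1 where h1: "h1 \<in> ?H" "y \<otimes> h1 \<in> set_power G S i" "y \<in> X"
        by (auto simp: Y_def)
      \<comment> \<open>The point \<open>v\<close> is replaced by a point of the same cell that
        already lies in \<open>S^i\<close>. Its product with \<open>s\<close> lies in
        \<open>S^(i+1)\<close>, whose cells are those of \<open>S^i\<close>.\<close>
      have "s \<otimes> (y \<otimes> h1) \<in> set_power G S (Suc i)"
        unfolding set_power_Suc using sv h1 by (intro set_multI) auto
      then obtain z h where z: "z \<in> Y (Suc i)" "h \<in> ?H" "s \<otimes> (y \<otimes> h1) = z \<otimes> h"
        using cell[of _ "Suc i"] step i X by (metis Suc_leI le_trans)
      have zi: "z \<in> Y i" "z \<in> X" using z(1) i(2) YX by auto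
      have car: "s \<in> carrier G" "x \<in> carrier G" "y \<in> carrier G" "z \<in> carrier G"
        "h \<in> carrier G" "h1 \<in> carrier G" "h2 \<in> carrier G" "h3 \<in> carrier G"
        using sv S x z zi y h1 Hc Xc by auto
      \<comment> \<open>This is \<open>inv z \<otimes> x\<close> after eliminating \<open>s\<close>
        from the two products; its four factors from \<open>H\<close> explain the separation radius
        \<open>4 * q\<close>.\<close>
      let ?g = "h \<otimes> inv h1 \<otimes> h2 \<otimes> inv h3"
      have "?g \<in> set_power G B (q + q + q + q)"
        using Hinv x y z h1 by (intro set_power_add_memI Bc) auto
      moreover have "q + q + q + q = 4 * q" by simp
      moreover have "x = z \<otimes> ?g"
      proof -
        have "x \<otimes> h3 = s \<otimes> (y \<otimes> h1) \<otimes> (inv h1 \<otimes> h2)"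
          using car sv y by (simp add: m_assoc) (simp add: m_assoc[symmetric])
        also have "\<dots> = z \<otimes> (h \<otimes> inv h1 \<otimes> h2)"
          using car z by (simp add: m_assoc)
        finally have "x = z \<otimes> (h \<otimes> inv h1 \<otimes> h2) \<otimes> inv h3"
          using car by (simp add: inv_solve_right)
        then show ?thesis using car by (simp add: m_assoc)
      qed
      then have "inv z \<otimes> x = ?g" using car by (simp add: inv_solve_left')
      ultimately have "inv z \<otimes> x \<in> set_power G B (4 * q)" by metis
      then have "x = z" using sep x zi by blast
      then show "x \<in> Y i" using zi by simp
    qed
  qed simp
  \<comment> \<open>The centres themselves need not lie in \<open>S^i\<close>, so each is replaced
    by a point of its cell that does, at the cost of a second factor \<open>H\<close>.\<close>
  have "\<exists>w. \<forall>x\<in>Y i. \<exists>h\<in>?H. w x = x \<otimes> h \<and> w x \<in> set_power G S i"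
    by (intro bchoice) (auto simp: Y_def)
  then obtain w where w: "\<And>x. x \<in> Y i \<Longrightarrow> \<exists>h\<in>?H. w x = x \<otimes> h"
    "\<And>x. x \<in> Y i \<Longrightarrow> w x \<in> set_power G S i" by metis
  let ?W = "w ` Y i"
  have finY: "finite (Y i)" using X(1) YX finite_subset by blast
  have Wc: "?W \<subseteq> carrier G" using w(2) Sc by blast
  have Sn: "set_power G S n \<subseteq> ?W <#> set_power G B (2 * q)"
  proof
    fix u assume u: "u \<in> set_power G S n"
    then obtain x h where x: "x \<in> Y n" "h \<in> ?H" "u = x \<otimes> h" using cell by blast
    have xi: "x \<in> Y i" "x \<in> X" using x stable[of n] i X YX[of n] by auto
    then obtain h' where h': "h' \<in> ?H" "w x = x \<otimes> h'" using w by blast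
    have "inv h' \<otimes> h \<in> set_power G B (q + q)"
      using Hinv x h' by (intro set_power_add_memI Bc) auto
    then have "w x \<otimes> (inv h' \<otimes> h) \<in> ?W <#> set_power G B (2 * q)"
      using xi by (intro set_multI) (auto simp: mult_2)
    moreover have "w x \<otimes> (inv h' \<otimes> h) = u"
    proof -
      have "x \<in> carrier G" "h \<in> carrier G" "h' \<in> carrier G" using x xi h' Hc Xc by auto
      then show ?thesis using x h' by (simp add: m_assoc) (simp add: m_assoc[symmetric])
    qed
    ultimately show "u \<in> ?W <#> set_power G B (2 * q)" by simp
  qed
  \<comment> \<open>As \<open>W\<close> reappears on the left of the right side, the inclusion can
    be iterated; each round adds \<open>n - i\<close> to the exponent of \<open>S\<close> and
    \<open>2 * q\<close> to that of \<open>B\<close>.\<close>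
  have step: "set_power G S (n - i) <#> ?W \<subseteq> ?W <#> set_power G B (2 * q)"
  proof -
    have "set_power G S (n - i) <#> ?W \<subseteq> set_power G S (n - i) <#> set_power G S i"
      using w(2) by (intro mono_set_mult) auto
    also have "\<dots> = set_power G S n"
      using i X by (simp add: set_power_add[OF S(1), symmetric])
    finally show ?thesis using Sn by blast
  qed
  show thesis
  proof (rule that)
    show "i < card X" by fact
    show "finite ?W" using finY by simp
    show "?W \<subseteq> carrier G" by fact
    show "card ?W \<le> card X"
      using card_image_le[OF finY, of w] card_mono[OF X(1) YX, of i] by linarith
    show "set_power G S (n + j * (n - i)) \<subseteq> ?W <#> set_power G B ((2 * j + 2) * q)" for j
    proof (induction j)
      case (Suc j)
      let ?P = "set_power G B"
      have "n + Suc j * (n - i) = (n - i) + (n + j * (n - i))" by simp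
      then have "set_power G S (n + Suc j * (n - i))
          = set_power G S (n - i) <#> set_power G S (n + j * (n - i))"
        by (simp only: set_power_add[OF S(1)])
      also have "\<dots> \<subseteq> set_power G S (n - i) <#> (?W <#> ?P ((2 * j + 2) * q))"
        using Suc by (intro mono_set_mult) auto
      also have "\<dots> = (set_power G S (n - i) <#> ?W) <#> ?P ((2 * j + 2) * q)"
        using set_power_closed[OF S(1)] set_power_closed[OF Bc] Wc by (simp add: set_mult_assoc)
      also have "\<dots> \<subseteq> (?W <#> ?P (2 * q)) <#> ?P ((2 * j + 2) * q)"
        by (rule mono_set_mult[OF step subset_refl])
      also have "\<dots> = ?W <#> ?P (2 * q + (2 * j + 2) * q)"
        using set_power_closed[OF Bc] Wc by (simp only: set_mult_assoc set_power_add[OF Bc])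
      also have "2 * q + (2 * j + 2) * q = (2 * Suc j + 2) * q" by (simp add: algebra_simps)
      finally show ?case .
    qed (use Sn in \<open>simp add: mult_2\<close>)
  qed
qed

section \<open>Ruzsa covering\<close>

text \<open>Choose a maximal family of disjoint translates \<open>xA\<close> with \<open>x\<close>
  in \<open>C\<close>. They pack into \<open>C <#> A\<close>, and any \<open>cA\<close> meets some
  \<open>xA\<close>, which puts \<open>c\<close> into \<open>x A A^(-1)\<close>.\<close>

lemma ruzsa_covering:
  assumes "A \<subseteq> carrier G" "finite A" "A \<noteq> {}" "C \<subseteq> carrier G" "finite C"
  obtains X where "X \<subseteq> C" "card X * card A \<le> card (C <#> A)"
    "C \<subseteq> (\<Union>x\<in>X. x <# (A <#> set_inv A))"
proof -
  obtain X where X: "X \<subseteq> C" "\<And>x y. x \<in> X \<Longrightarrow> y \<in> X \<Longrightarrow> x \<noteq> y \<Longrightarrow> \<not> (\<otimes>) x ` A \<inter> (\<otimes>) y ` A \<noteq> {}"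
    "\<And>c. c \<in> C \<Longrightarrow> \<exists>x\<in>X. (\<otimes>) x ` A \<inter> (\<otimes>) c ` A \<noteq> {}"
    using assms(3,5) by (rule_tac maximal_separated[of C "\<lambda>x y. (\<otimes>) x ` A \<inter> (\<otimes>) y ` A \<noteq> {}"]) auto
  have car: "x \<in> carrier G" if "x \<in> X" for x using X that assms by blast
  have "finite X" using X assms finite_subset by blast
  show thesis
  proof
    show "X \<subseteq> C" by (rule X)
    have "card (\<Union>x\<in>X. (\<otimes>) x ` A) = (\<Sum>x\<in>X. card ((\<otimes>) x ` A))"
      using \<open>finite X\<close> assms X(2) by (intro card_UN_disjoint) blast+
    also have "\<dots> = card X * card A"
      using assms car by (simp add: card_l_coset)
    finally have "card X * card A = card (\<Union>x\<in>X. (\<otimes>) x ` A)" ..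
    also have "\<dots> \<le> card (C <#> A)"
      using X(1) assms by (intro card_mono finite_set_mult) (auto simp: set_mult_def)
    finally show "card X * card A \<le> card (C <#> A)" .
    show "C \<subseteq> (\<Union>x\<in>X. x <# (A <#> set_inv A))"
    proof
      fix c assume c: "c \<in> C"
      then obtain x a b where x: "x \<in> X" "a \<in> A" "b \<in> A" "x \<otimes> a = c \<otimes> b"
        using X(3) by blast
      then have ca: "x \<in> carrier G" "a \<in> carrier G" "b \<in> carrier G" "c \<in> carrier G"
        using assms car c by auto
      then have "c = x \<otimes> (a \<otimes> inv b)"
        using x by (simp add: m_assoc[symmetric] inv_solve_right)
      moreover have "a \<otimes> inv b \<in> A <#> set_inv A"
        using x by (intro set_multI) (auto simp: SET_INV_def)
      ultimately show "c \<in> (\<Union>x\<in>X. x <# (A <#> set_inv A))"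
        using x by (auto simp: l_coset_def)
    qed
  qed
qed

section \<open>Quantitative growth bounds and the conclusion\<close>

text \<open>Each of \<open>j\<close> rounds advances by at least \<open>n / 2\<close>, which
  explains the condition on \<open>l\<close>. The exponent is \<open>(2 * j + 2) * q\<close> with
  \<open>q\<close> at most \<open>5 powr (K ^ 2)\<close>.\<close>

lemma cover_of_doubling:
  assumes "finite S" "symmetric_subset G S" "\<one> \<in> S" "1 \<le> K" "2 * K ^ 2 \<le> real n"
    and dbl: "real (card (set_power G S (2 * n))) \<le> K * real (card (set_power G S n))"
    and l: "2 * l \<le> (j + 2) * n"
  shows "real (card (set_power G S l))
    \<le> (3 ^ 9 * K ^ 18) powr (real (2 * j + 2) * 5 powr (K ^ 2)) * real (card (set_power G S n))"
proof -
  let ?A = "set_power G S n"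
  let ?d = "1 / (9 * K ^ 3)"
  let ?B = "popular ?A ?d"
  have S: "S \<subseteq> carrier G" using assms by (simp add: symmetric_subset_iff)
  have A: "?A \<subseteq> carrier G" "finite ?A" "\<one> \<in> ?A" "symmetric_subset G ?A"
    using assms S by (simp_all add: set_power_closed finite_set_power one_in_set_power
      symmetric_subset_set_power)
  have AA: "?A <#> ?A = set_power G S (2 * n)"
    by (simp add: mult_2 set_power_add[OF S])
  have K: "0 < K" "1 \<le> K ^ 2" "1 \<le> K ^ 3" "1 \<le> K ^ 4" "1 \<le> K ^ 14" "K ^ 2 \<le> K ^ 14"
    using assms(4) by (auto intro: power_increasing)
  have d: "0 < ?d" "?d \<le> 1" using K by (simp_all add: pos_divide_le_eq)
  then have B: "symmetric_subset G ?B" "\<one> \<in> ?B"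
    using A by (auto intro: symmetric_popular one_in_popular)
  obtain X where X: "X \<subseteq> ?A" "real (card X) \<le> K ^ 2 + 1" "?A \<subseteq> X <#> set_power G ?B 1"
    using popular_cover[of ?A K] A AA dbl assms(4)
    by (metis One_nat_def popular_closed set_power_1)
  have fX: "finite X" and Xc: "X \<subseteq> carrier G" using X A finite_subset by auto
  obtain Y q where Y: "Y \<subseteq> X" "q \<le> 1 * 5 ^ (card X - 1)" "?A \<subseteq> Y <#> set_power G ?B q"
    "\<And>x y. x \<in> Y \<Longrightarrow> y \<in> Y \<Longrightarrow> x \<noteq> y \<Longrightarrow> inv x \<otimes> y \<notin> set_power G ?B (4 * q)"
    using merge_cover[OF popular_closed B(2) fX Xc X(3)] by metis
  have cYX: "card Y \<le> card X" using Y(1) fX by (simp add: card_mono)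
  then have cY: "real (card Y) \<le> K ^ 2 + 1" using X(2) by linarith
  then have "2 * card Y \<le> n + 2" using assms(5) by linarith
  moreover have "2 \<le> n" using K(2) assms(5) by linarith
  ultimately have Yn: "card Y \<le> n" by linarith
  have fY: "finite Y" "Y \<subseteq> carrier G" using Y(1) fX Xc finite_subset by auto
  obtain i W where W: "i < card Y" "finite W" "W \<subseteq> carrier G" "card W \<le> card Y"
    "\<And>j. set_power G S (n + j * (n - i)) \<subseteq> W <#> set_power G ?B ((2 * j + 2) * q)"
    by (rule stable_cover[OF S assms(3) B fY Yn Y(3)], erule (2) Y(4), rule that)
  define p where "p = (2 * j + 2) * q"
  define P where "P = real (2 * j + 2) * 5 powr (K ^ 2)"
  \<comment> \<open>Here \<open>n \<ge> 2 * K ^ 2\<close> enters: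
    \<open>i \<le> card Y - 1 \<le> K ^ 2\<close>, hence \<open>n - i \<ge> n / 2\<close>.\<close>
  have "2 * i \<le> n" using W(1) \<open>2 * card Y \<le> n + 2\<close> by linarith
  then have "j * n \<le> j * (2 * (n - i))" by (intro mult_le_mono2) linarith
  then have "2 * l \<le> 2 * (n + j * (n - i))" using l by (simp add: algebra_simps)
  then have "l \<le> n + j * (n - i)" by simp
  then have "set_power G S l \<subseteq> W <#> set_power G ?B p"
    using set_power_mono[OF S assms(3)] W(5) unfolding p_def by blast
  moreover have fB: "finite (set_power G ?B p)"
    by (rule finite_set_power, rule finite_popular) (use A d in auto)
  ultimately have "card (set_power G S l) \<le> card (W <#> set_power G ?B p)"
    using W(2) by (intro card_mono finite_set_mult)
  also have "\<dots> \<le> card W * card (set_power G ?B p)"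
    using W(2) fB by (rule card_set_mult_le)
  finally have "real (card (set_power G S l)) \<le> real (card W) * real (card (set_power G ?B p))"
    by (metis of_nat_le_iff of_nat_mult)
  also have "\<dots> \<le> (2 * K ^ 2) * ((9 * K ^ 4) powr P * real (card ?A))"
  proof (rule mult_mono)
    show "real (card W) \<le> 2 * K ^ 2" using W(4) cY K by linarith
    have "real (card (set_power G ?B p)) \<le> (K / ?d) ^ p * real (card ?A)"
    proof (rule card_set_power_popular_le)
      show "inv b \<otimes> a \<in> ?A <#> ?A" if "a \<in> ?A" "b \<in> ?A" for a b
        using that A by (intro set_multI) (auto simp: symmetric_subset_iff)
    qed (use A d AA dbl set_power_closed[OF S] finite_set_power[OF assms(1)] in auto)
    also have "K / ?d = 9 * K ^ 4" by (simp add: power_numeral_reduce)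
    also have "(9 * K ^ 4) ^ p = (9 * K ^ 4) powr real p"
      using K by (subst powr_realpow) auto
    also have "\<dots> \<le> (9 * K ^ 4) powr P"
    proof (rule powr_mono)
      have "real (card X - 1) \<le> K ^ 2" using X(2) K by (cases "card X") auto
      have "real q \<le> 5 ^ (card X - 1)"
        using Y(2) by (metis mult_1 of_nat_le_iff of_nat_numeral of_nat_power)
      also have "\<dots> = 5 powr real (card X - 1)" by (simp add: powr_realpow)
      also have "\<dots> \<le> 5 powr (K ^ 2)" using \<open>real (card X - 1) \<le> K ^ 2\<close> by simp
      finally show "real p \<le> P"
        unfolding p_def P_def of_nat_mult by (intro mult_left_mono) auto
    qed (use K in simp)
    finally show "real (card (set_power G ?B p)) \<le> (9 * K ^ 4) powr P * real (card ?A)"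
      by (simp add: mult_right_mono)
  qed auto
  \<comment> \<open>Since \<open>P\<close> is at least 1, the factor \<open>2 * K ^ 2\<close> is
    absorbed into \<open>(3 ^ 7 * K ^ 14) powr P\<close>, and the two bases multiply to
    \<open>3 ^ 9 * K ^ 18\<close>.\<close>
  also have "\<dots> \<le> (3 ^ 9 * K ^ 18) powr P * real (card ?A)"
  proof -
    have "1 \<le> P"
    proof -
      have "1 * 1 \<le> real (2 * j + 2) * 5 powr (K ^ 2)"
        using K by (intro mult_mono ge_one_powr_ge_zero) auto
      then show ?thesis by (simp add: P_def)
    qed
    have "2 * K ^ 2 \<le> 3 ^ 7 * K ^ 14" using K by simp
    also have "\<dots> = (3 ^ 7 * K ^ 14) powr 1" using K by simp
    also have "\<dots> \<le> (3 ^ 7 * K ^ 14) powr P"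
      using K \<open>1 \<le> P\<close> by (intro powr_mono) auto
    finally have "2 * K ^ 2 * (9 * K ^ 4) powr P \<le> (3 ^ 7 * K ^ 14) powr P * (9 * K ^ 4) powr P"
      by (intro mult_right_mono) auto
    also have "\<dots> = ((3 ^ 7 * K ^ 14) * (9 * K ^ 4)) powr P"
      using K by (subst powr_mult) auto
    also have "(3 ^ 7 * K ^ 14) * (9 * K ^ 4) = 3 ^ 9 * K ^ 18"
      by (simp add: power_numeral_reduce)
    finally show ?thesis
      by (metis mult.assoc mult_right_mono of_nat_0_le_iff)
  qed
  finally show ?thesis unfolding P_def .
qed

end

theorem theorem1p4:
  fixes G :: "('a, 'b) monoid_scheme" and S :: "'a set" and K :: real and n :: nat
  assumes "group G"
    and "1 \<le> K"
    and "finite S"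
    and "symmetric_subset G S"
    and "\<one>\<^bsub>G\<^esub> \<in> S"
    and "real n \<ge> 2 * K ^ 2"
    and "real (card (set_power G S (2 * n))) \<le> K * real (card (set_power G S n))"
  shows "real (card (set_power G S (3 * n)))
           \<le> K ^ 3 * (3 ^ 9 * K ^ 18) powr (10 * 5 powr (K ^ 2)) * real (card (set_power G S n))
         \<and> approximate_group G (K ^ 9 * (3 ^ 9 * K ^ 18) powr (30 * 5 powr (K ^ 2)))
             (set_power G S (2 * n))"
proof
  interpret group G by fact
  let ?A = "set_power G S n"
  let ?b = "3 ^ 9 * K ^ 18"
  let ?P = "5 powr (K ^ 2)"
  have K: "0 < K" "1 \<le> K ^ 3" "1 \<le> K ^ 9" "1 \<le> K ^ 18" using assms(2) by simp_all
  have S: "S \<subseteq> carrier G" using assms by (simp add: symmetric_subset_iff)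
  have A: "?A \<subseteq> carrier G" "finite ?A" "\<one>\<^bsub>G\<^esub> \<in> ?A" "symmetric_subset G ?A"
    using assms S by (simp_all add: set_power_closed finite_set_power one_in_set_power
      symmetric_subset_set_power)
  note cover = cover_of_doubling[OF assms(3-5,2,6,7)]
  \<comment> \<open>The choice \<open>j = 4\<close> reaches \<open>3 * n\<close> and yields the
    exponent \<open>2 * 4 + 2 = 10\<close>.\<close>
  have "real (card (set_power G S (3 * n))) \<le> 1 * ?b powr (10 * ?P) * real (card ?A)"
    using cover[of "3 * n" 4] by simp
  also have "\<dots> \<le> K ^ 3 * ?b powr (10 * ?P) * real (card ?A)"
    using K by (intro mult_right_mono) auto
  finally show "real (card (set_power G S (3 * n))) \<le> K ^ 3 * ?b powr (10 * ?P) * real (card ?A)" .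
  let ?L = "K ^ 9 * ?b powr (30 * ?P)"
  have bL: "?b powr (18 * ?P) \<le> ?L"
  proof -
    have "1 * ?b powr (18 * ?P) \<le> ?L"
      using K by (intro mult_mono powr_mono) auto
    then show ?thesis by simp
  qed
  have "1 \<le> ?b powr (18 * ?P)" using K by (intro ge_one_powr_ge_zero) auto
  then have "1 \<le> ?L" using bL by linarith
  \<comment> \<open>With \<open>C = S^(4n)\<close> and \<open>A = S^n\<close>, the packing takes
    place in \<open>S^(5n)\<close>, bounded below with \<open>j = 8\<close> and exponent 18, and
    \<open>A A^(-1)\<close> is \<open>S^(2n)\<close>. So translates of \<open>S^(2n)\<close> cover
    its square \<open>S^(4n)\<close>.\<close>
  obtain X where X: "X \<subseteq> set_power G S (4 * n)" "card X * card ?A \<le> card (set_power G S (4 * n) <#>\<^bsub>G\<^esub> ?A)"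
    "set_power G S (4 * n) \<subseteq> (\<Union>x\<in>X. x <#\<^bsub>G\<^esub> (?A <#>\<^bsub>G\<^esub> set_inv\<^bsub>G\<^esub> ?A))"
    using ruzsa_covering[of ?A "set_power G S (4 * n)"] A assms(3) S
    by (metis empty_iff finite_set_power set_power_closed)
  have "set_power G S (4 * n) <#>\<^bsub>G\<^esub> ?A = set_power G S (5 * n)"
    using set_power_add[OF S, of "4 * n" n] by simp
  then have "real (card X) * real (card ?A) \<le> real (card (set_power G S (5 * n)))"
    using X(2) by (metis of_nat_le_iff of_nat_mult)
  also have "\<dots> \<le> ?b powr (18 * ?P) * real (card ?A)"
    using cover[of "5 * n" 8] by simp
  finally have "real (card X) \<le> ?b powr (18 * ?P)"
    using A by (metis card_gt_0_iff empty_iff mult_le_cancel_right_pos of_nat_0_less_iff)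
  then have "real (card X) \<le> ?L" using bL by linarith
  moreover have "finite X" "X \<subseteq> carrier G"
    using X(1) finite_set_power[OF assms(3)] set_power_closed[OF S] finite_subset by blast+
  moreover have "?A <#>\<^bsub>G\<^esub> set_inv\<^bsub>G\<^esub> ?A = set_power G S (2 * n)"
    using A(4) by (simp add: symmetric_subset_def mult_2 set_power_add[OF S])
  moreover have "set_power G (set_power G S (2 * n)) 2 = set_power G S (4 * n)"
    using set_power_add[OF S, of "2 * n" "2 * n"] set_power_closed[OF S] by (simp add: set_power_2)
  ultimately show "approximate_group G ?L (set_power G S (2 * n))"
    unfolding approximate_group_def using \<open>1 \<le> ?L\<close> X(3) assms
    by (auto simp: symmetric_subset_set_power one_in_set_power)
qed

end
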